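(* Let $P:\mathbb{R}^n\to\mathbb{R}^m$ be a sampling operator and let $V\in\mathbb{R}^{n\times r}$ and $W\in\mathbb{R}^{n\times p}$, $p=r(r+1)/2$, be constructed by the QMSR method, i.e. obtained from a data matrix $S\in\mathbb{R}^{n\times k}$ with the sparse greedy procedure (described in the context) with regularization parameter $\gamma>0$, so that $W$ solves $$\min_{W\in\mathbb{R}^{n\times p}}\ \bigl\|V f_{V,P}(PS)+W\,h\bigl(f_{V,P}(PS)\bigr)-S\bigr\|_F^2+\gamma\|W\|_F^2 .$$ For $s\in\mathbb{R}^n$ denote the QMSR approximation by $\hat s=g_{V,W}\bigl(f_{V,P}(Ps)\bigr)$. If $m\ge r$ and $PV$ has full column rank, then for every point $s\in\mathcal{M}_r(V,W)$ the QMSR approximation satisfies $\hat s=s$.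
   Context: Sampling operator: for indices $i_1,\dots,i_m\in\{1,\dots,n\}$, $P:\mathbb{R}^n\to\mathbb{R}^m$ is the linear map $Ps=(s_{i_1},\dots,s_{i_m})^\top$ that selects the components of $s=(s_1,\dots,s_n)^\top$ with these indices. Applied to a matrix with $n$ rows, it acts column-wise. Quadratic feature map: for any dimension $d$, $h:\mathbb{R}^d\to\mathbb{R}^{d(d+1)/2}$, $h(z)=(z_1z_1,\,z_1z_2,\dots,z_1z_d,\,z_2z_2,\dots,z_dz_d)^\top$, i.e. all products $z_az_b$ with $a\le b$. Applied to a matrix, it acts column-wise. Sparse linear encoder: for a matrix $V$ with $n$ rows, $f_{V,P}(y)=(PV)^+y$ for $y\in\mathbb{R}^m$, where $^+$ is the Moore–Penrose pseudo-inverse. Applied to a matrix, it acts column-wise. Quadratic decoder: $g_{V,W}(z)=Vz+Wh(z)$ for $z\in\mathbb{R}^r$. Quadratic manifold (a set, not necessarily a manifold): $\mathcal{M}_r(V,W)=\{Vz+Wh(z): z\in\mathbb{R}^r\}\subset\mathbb{R}^n$. Sparse greedy procedure: given $S\in\mathbb{R}^{n\times k}$, $P$, $\gamma>0$ and $q>r$, let $\varphi_1,\dots,\varphi_q\in\mathbb{R}^n$ be the first $q$ (orthonormal) left-singular vectors of $S$, ordered by descending singular values. Start with the empty matrix $V_0\in\mathbb{R}^{n\times 0}$. In iteration $i=1,\dots,r$, choose an index $j_i\in\{1,\dots,q\}$ (distinct from the previous ones, so that the columns of $[V_{i-1},\varphi_{j_i}]$ are orthonormal) that minimizes $\min_{W}J(\varphi_{j_i},V_{i-1},W)$,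 where $W$ ranges over $\mathbb{R}^{n\times i(i+1)/2}$ and $$J(v,V,W)=\bigl\|[V,v]f_{[V,v],P}(PS)+W\,h\bigl(f_{[V,v],P}(PS)\bigr)-S\bigr\|_F^2+\gamma\|W\|_F^2,$$ and set $V_i=[\varphi_{j_1},\dots,\varphi_{j_i}]$. Finally $V=V_r$, and $W\in\mathbb{R}^{n\times p}$ is the minimizer of $\|V f_{V,P}(PS)+W h(f_{V,P}(PS))-S\|_F^2+\gamma\|W\|_F^2$. $\|\cdot\|_F$ is the Frobenius norm. *)

theory Defs
  imports Complex_Main "Jordan_Normal_Form.DL_Rank"
begin

text \<open>Vectors and matrices are indexed from 0, so indices range over \<open>{..<n}\<close>.
  A sampling operator from \<open>\<real>\<^sup>n\<close> to \<open>\<real>\<^sup>m\<close> is given by the list of the \<open>m\<close> selected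
  indices, and an \<open>n\<close>-by-\<open>r\<close> matrix by an element of \<open>carrier_mat n r\<close>.\<close>

definition colwise :: "nat \<Rightarrow> (real vec \<Rightarrow> real vec) \<Rightarrow> real mat \<Rightarrow> real mat" where
  "colwise d f A = mat_of_cols d (map f (cols A))"

definition sample :: "nat list \<Rightarrow> real vec \<Rightarrow> real vec" where
  "sample I s = vec_of_list (map (\<lambda>i. s $ i) I)"

abbreviation sample_mat :: "nat list \<Rightarrow> real mat \<Rightarrow> real mat" where
  "sample_mat I A \<equiv> colwise (length I) (sample I) A"

definition quad_feature :: "real vec \<Rightarrow> real vec" where
  "quad_feature z =
     vec_of_list (concat (map (\<lambda>a. map (\<lambda>b. z $ a * z $ b) [a..<dim_vec z]) [0..<dim_vec z]))"

definition quad_dim :: "nat \<Rightarrow> nat" where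
  "quad_dim d = d * (d + 1) div 2"

lemma dim_quad_feature: "dim_vec (quad_feature z) = quad_dim (dim_vec z)"
proof -
  have aux: "2 * sum_list (map (\<lambda>a. d + e - a) [0..<d]) = d * (d + 1) + 2 * d * e" for d e :: nat
  proof (induction d arbitrary: e)
    case (Suc d)
    show ?case using Suc[of "Suc e"] by (simp add: algebra_simps)
  qed simp
  show ?thesis using aux[of "dim_vec z" 0]
    by (simp add: quad_feature_def quad_dim_def length_concat comp_def del: upt_Suc)
qed

text \<open>The four Penrose conditions; every real matrix has exactly one such \<open>B\<close>.\<close>

definition is_pseudo_inverse :: "real mat \<Rightarrow> real mat \<Rightarrow> bool" where
  "is_pseudo_inverse A B \<longleftrightarrow>
     B \<in> carrier_mat (dim_col A) (dim_row A) \<and>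
     A * B * A = A \<and> B * A * B = B \<and>
     transpose_mat (A * B) = A * B \<and> transpose_mat (B * A) = B * A"

definition pseudo_inverse :: "real mat \<Rightarrow> real mat" where
  "pseudo_inverse A = (THE B. is_pseudo_inverse A B)"

definition encoder :: "nat list \<Rightarrow> real mat \<Rightarrow> real vec \<Rightarrow> real vec" where
  "encoder I V y = pseudo_inverse (sample_mat I V) *\<^sub>v y"

definition decoder :: "real mat \<Rightarrow> real mat \<Rightarrow> real vec \<Rightarrow> real vec" where
  "decoder V W z = V *\<^sub>v z + W *\<^sub>v quad_feature z"

definition quadratic_manifold :: "nat \<Rightarrow> real mat \<Rightarrow> real mat \<Rightarrow> real vec set" where
  "quadratic_manifold r V W = {V *\<^sub>v z + W *\<^sub>v quad_feature z | z. z \<in> carrier_vec r}"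

definition frobenius_norm :: "real mat \<Rightarrow> real" where
  "frobenius_norm A = sqrt (\<Sum>i<dim_row A. \<Sum>j<dim_col A. (A $$ (i, j))\<^sup>2)"

definition objective :: "nat list \<Rightarrow> real mat \<Rightarrow> real \<Rightarrow> real mat \<Rightarrow> real mat \<Rightarrow> real" where
  "objective I S \<gamma> V W =
     (let Z = colwise (dim_col V) (encoder I V) (sample_mat I S);
          H = colwise (quad_dim (dim_col V)) quad_feature Z
      in (frobenius_norm (V * Z + W * H - S))\<^sup>2 + \<gamma> * (frobenius_norm W)\<^sup>2)"

definition append_column :: "real mat \<Rightarrow> real vec \<Rightarrow> real mat" where
  "append_column V v = mat_of_cols (dim_row V) (cols V @ [v])"

definition greedy_J ::
  "nat list \<Rightarrow> real mat \<Rightarrow> real \<Rightarrow> real vec \<Rightarrow> real mat \<Rightarrow> real mat \<Rightarrow> real" where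
  "greedy_J I S \<gamma> v V W = objective I S \<gamma> (append_column V v) W"

text \<open>For \<open>\<gamma> > 0\<close> the objective is a strictly convex quadratic function of \<open>W\<close>, so the
  infimum is attained and is the minimum over \<open>W\<close>.\<close>

definition min_J :: "nat list \<Rightarrow> real mat \<Rightarrow> real \<Rightarrow> real vec \<Rightarrow> real mat \<Rightarrow> real" where
  "min_J I S \<gamma> v V =
     (INF W \<in> carrier_mat (dim_row V) (quad_dim (dim_col V + 1)). greedy_J I S \<gamma> v V W)"

definition is_svd :: "real mat \<Rightarrow> real mat \<Rightarrow> real mat \<Rightarrow> real mat \<Rightarrow> bool" where
  "is_svd S U D X \<longleftrightarrow>
     (let n = dim_row S; k = dim_col S in
      U \<in> carrier_mat n n \<and> D \<in> carrier_mat n k \<and> X \<in> carrier_mat k k \<and>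
      transpose_mat U * U = 1\<^sub>m n \<and> transpose_mat X * X = 1\<^sub>m k \<and>
      diagonal_mat D \<and>
      (\<forall>i < min n k. 0 \<le> D $$ (i, i)) \<and>
      (\<forall>i j. i \<le> j \<longrightarrow> j < min n k \<longrightarrow> D $$ (j, j) \<le> D $$ (i, i)) \<and>
      S = U * D * transpose_mat X)"

text \<open>The list \<open>\<phi>s\<close> is formed by the first \<open>q\<close> columns of the left factor of a full singular value
  decomposition of \<open>S\<close>. It is not unique in general.\<close>

definition leading_left_singular_vectors :: "real mat \<Rightarrow> nat \<Rightarrow> real vec list \<Rightarrow> bool" where
  "leading_left_singular_vectors S q \<phi>s \<longleftrightarrow>
     q \<le> dim_row S \<and> (\<exists>U D X. is_svd S U D X \<and> \<phi>s = take q (cols U))"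

definition basis_mat :: "nat \<Rightarrow> real vec list \<Rightarrow> nat list \<Rightarrow> real mat" where
  "basis_mat n \<phi>s js = mat_of_cols n (map (\<lambda>j. \<phi>s ! j) js)"

text \<open>\<open>greedy_selection I S \<gamma> \<phi>s js\<close>: the greedy iteration can choose the indices \<open>js\<close>, in this
  order. Ties between minimizing indices may be broken arbitrarily.\<close>

inductive greedy_selection ::
  "nat list \<Rightarrow> real mat \<Rightarrow> real \<Rightarrow> real vec list \<Rightarrow> nat list \<Rightarrow> bool"
  for I S \<gamma> \<phi>s where
  Nil: "greedy_selection I S \<gamma> \<phi>s []"
| Snoc: "greedy_selection I S \<gamma> \<phi>s js \<Longrightarrow>
    is_arg_min (\<lambda>j. min_J I S \<gamma> (\<phi>s ! j) (basis_mat (dim_row S) \<phi>s js))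
      (\<lambda>j. j < length \<phi>s \<and> j \<notin> set js) j \<Longrightarrow>
    greedy_selection I S \<gamma> \<phi>s (js @ [j])"

definition qmsr :: "nat list \<Rightarrow> real mat \<Rightarrow> real \<Rightarrow> nat \<Rightarrow> nat \<Rightarrow> real mat \<Rightarrow> real mat \<Rightarrow> bool" where
  "qmsr I S \<gamma> q r V W \<longleftrightarrow>
     (\<exists>\<phi>s js. leading_left_singular_vectors S q \<phi>s \<and>
        greedy_selection I S \<gamma> \<phi>s js \<and> length js = r \<and>
        V = basis_mat (dim_row S) \<phi>s js) \<and>
     is_arg_min (objective I S \<gamma> V) (\<lambda>W. W \<in> carrier_mat (dim_row S) (quad_dim r)) W"

end

theory Submission
  imports Defs
begin

text \<open>Write \<open>B = (P V)\<^sup>+ P\<close> for the matrix that maps a state to its encoding. The theorem says that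
  \<open>B (V z + W h(z)) = z\<close> for all \<open>z\<close>. Full column rank of \<open>P V\<close> makes its pseudo-inverse a left
  inverse, so \<open>B V = 1\<close> (\<open>pseudo_inverse_left_inverse\<close>), and it remains to see that \<open>B W = 0\<close>: the
  encoder does not notice the quadratic correction.

  This is forced by the minimality of \<open>W\<close> (\<open>minimizer_annihilated\<close>). Let \<open>Z = B S\<close> be the encoded
  data and \<open>H = h(Z)\<close>. The target \<open>S - V Z\<close> of the regression satisfies
  \<open>B (S - V Z) = Z - B V Z = 0\<close>, and the fit inherits this property, because the stationarity
  condition \<open>(V Z + W H - S) H\<^sup>T + \<gamma> W = 0\<close>, multiplied by \<open>B\<close> from the left, reads
  \<open>X H H\<^sup>T + \<gamma> X = 0\<close> for \<open>X = B W\<close>. Taking the Frobenius inner product with \<open>X\<close> gives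
  \<open>\<parallel>X H\<parallel>\<^sup>2 + \<gamma> \<parallel>X\<parallel>\<^sup>2 = 0\<close>, hence \<open>X = 0\<close> as \<open>\<gamma> > 0\<close>. In the formal argument, the stationarity
  condition is only used in the direction \<open>B\<^sup>T X\<close>, which yields the last equation at once.\<close>

section \<open>The Frobenius inner product\<close>

text \<open>Summation by columns reduces the adjoint rule below to the one for vectors.\<close>

definition frob_inner :: "real mat \<Rightarrow> real mat \<Rightarrow> real" where
  "frob_inner A B = (\<Sum>j<dim_col A. col A j \<bullet> col B j)"

lemma frobenius_norm_sq: "(frobenius_norm A)\<^sup>2 = frob_inner A A"
proof -
  have "(frobenius_norm A)\<^sup>2 = (\<Sum>i<dim_row A. \<Sum>j<dim_col A. (A $$ (i, j))\<^sup>2)"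
    unfolding frobenius_norm_def by (intro real_sqrt_pow2 sum_nonneg) auto
  also have "\<dots> = (\<Sum>j<dim_col A. \<Sum>i<dim_row A. (A $$ (i, j))\<^sup>2)"
    by (rule sum.swap)
  also have "\<dots> = frob_inner A A"
    by (simp add: frob_inner_def scalar_prod_def power2_eq_square lessThan_atLeast0)
  finally show ?thesis .
qed

lemma frobenius_norm_eq_0:
  assumes "A \<in> carrier_mat nr nc" and "frobenius_norm A = 0"
  shows "A = 0\<^sub>m nr nc"
proof (rule eq_matI)
  fix i j assume ij: "i < dim_row (0\<^sub>m nr nc :: real mat)" "j < dim_col (0\<^sub>m nr nc :: real mat)"
  have "(\<Sum>i<nr. \<Sum>j<nc. (A $$ (i, j))\<^sup>2) = 0"
    using assms by (simp add: frobenius_norm_def)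
  then have "(\<Sum>j<nc. (A $$ (i, j))\<^sup>2) = 0"
    using ij by (subst (asm) sum_nonneg_eq_0_iff) (auto intro: sum_nonneg)
  then have "(A $$ (i, j))\<^sup>2 = 0"
    using ij by (subst (asm) sum_nonneg_eq_0_iff) auto
  then show "A $$ (i, j) = 0\<^sub>m nr nc $$ (i, j)"
    using ij by simp
qed (use assms in auto)

lemma frob_inner_adjoint:
  assumes "A \<in> carrier_mat nr nc" and "X \<in> carrier_mat nc k" and "Y \<in> carrier_mat nr k"
  shows "frob_inner X (transpose_mat A * Y) = frob_inner (A * X) Y"
proof -
  have "col X j \<bullet> col (transpose_mat A * Y) j = col (A * X) j \<bullet> col Y j" if "j < k" for j
  proof -
    have c: "col X j \<in> carrier_vec nc" "col Y j \<in> carrier_vec nr"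
      using assms by auto
    have "col (transpose_mat A * Y) j = transpose_mat A *\<^sub>v col Y j"
         "col (A * X) j = A *\<^sub>v col X j"
      using assms that by (auto intro!: col_mult2)
    moreover have "col X j \<bullet> (transpose_mat A *\<^sub>v col Y j) = (transpose_mat A *\<^sub>v col Y j) \<bullet> col X j"
      using assms c by (intro comm_scalar_prod[of _ nc]) auto
    moreover have "col Y j \<bullet> (A *\<^sub>v col X j) = (A *\<^sub>v col X j) \<bullet> col Y j"
      using assms c by (intro comm_scalar_prod[of _ nr]) auto
    ultimately show ?thesis
      using transpose_vec_mult_scalar[OF assms(1) c] by simp
  qed
  then show ?thesis
    using assms by (simp add: frob_inner_def)
qed

lemma frobenius_norm_sq_add_smult:
  assumes "A \<in> carrier_mat nr nc" and "E \<in> carrier_mat nr nc"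
  shows "(frobenius_norm (A + t \<cdot>\<^sub>m E))\<^sup>2 =
    (frobenius_norm A)\<^sup>2 + 2 * t * frob_inner A E + t\<^sup>2 * (frobenius_norm E)\<^sup>2"
proof -
  have "col (A + t \<cdot>\<^sub>m E) j \<bullet> col (A + t \<cdot>\<^sub>m E) j =
      col A j \<bullet> col A j + 2 * t * (col A j \<bullet> col E j) + t\<^sup>2 * (col E j \<bullet> col E j)"
    if "j < nc" for j
  proof -
    have "col (A + t \<cdot>\<^sub>m E) j \<bullet> col (A + t \<cdot>\<^sub>m E) j =
        (\<Sum>i = 0..<nr. (A $$ (i, j) + t * E $$ (i, j)) * (A $$ (i, j) + t * E $$ (i, j)))"
      using assms that by (simp add: scalar_prod_def)
    also have "\<dots> = (\<Sum>i = 0..<nr. A $$ (i, j) * A $$ (i, j) +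
        2 * t * (A $$ (i, j) * E $$ (i, j)) + t\<^sup>2 * (E $$ (i, j) * E $$ (i, j)))"
      by (intro sum.cong refl) (simp add: power2_eq_square algebra_simps)
    finally show ?thesis
      using assms that by (simp add: scalar_prod_def sum.distrib sum_distrib_left)
  qed
  then show ?thesis
    using assms
    by (simp add: frobenius_norm_sq frob_inner_def sum.distrib sum_distrib_left del: col_add)
qed

section \<open>Pseudo-inverses of matrices of full column rank\<close>

lemma is_pseudo_inverse_unique:
  assumes B: "is_pseudo_inverse A B" and C: "is_pseudo_inverse A C"
  shows "B = C"
proof -
  define m n where "m = dim_row A" and "n = dim_col A"
  have A: "A \<in> carrier_mat m n" by (simp add: m_def n_def)
  have cB: "B \<in> carrier_mat n m" and cC: "C \<in> carrier_mat n m"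
    using B C by (auto simp: is_pseudo_inverse_def m_def n_def)
  have AB_carrier: "A * B \<in> carrier_mat m m" and AC_carrier: "A * C \<in> carrier_mat m m"
    and BA_carrier: "B * A \<in> carrier_mat n n" and CA_carrier: "C * A \<in> carrier_mat n n"
    using mult_carrier_mat[OF A cB] mult_carrier_mat[OF A cC] mult_carrier_mat[OF cB A]
      mult_carrier_mat[OF cC A] .
  note b = B[unfolded is_pseudo_inverse_def, THEN conjunct2]
  note c = C[unfolded is_pseudo_inverse_def, THEN conjunct2]
  \<comment> \<open>\<open>A B\<close> and \<open>A C\<close> are both the orthogonal projection onto the column space of \<open>A\<close>.\<close>
  have "A * B = transpose_mat ((A * C * A) * B)" using b c by simp
  also have "(A * C * A) * B = (A * C) * (A * B)"
    by (rule assoc_mult_mat[OF AC_carrier A cB])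
  also have "transpose_mat ((A * C) * (A * B)) = (A * B) * (A * C)"
    using b c transpose_mult[OF AC_carrier AB_carrier] by simp
  also have "\<dots> = (A * B * A) * C"
    by (rule assoc_mult_mat[OF AB_carrier A cC, symmetric])
  finally have AB: "A * B = A * C" using b by simp
  \<comment> \<open>\<open>B A\<close> and \<open>C A\<close> are both the orthogonal projection onto the row space of \<open>A\<close>.\<close>
  have "B * A = transpose_mat (B * (A * C * A))" using b c by simp
  also have "B * (A * C * A) = (B * A) * (C * A)"
    using assoc_mult_mat[OF A cC A] assoc_mult_mat[OF cB A CA_carrier] by metis
  also have "transpose_mat ((B * A) * (C * A)) = (C * A) * (B * A)"
    using b c transpose_mult[OF BA_carrier CA_carrier] by simp
  also have "\<dots> = C * (A * B * A)"
    using assoc_mult_mat[OF A cB A] assoc_mult_mat[OF cC A BA_carrier] by metis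
  finally have BA: "B * A = C * A" using b by simp
  have "B = B * A * B" using b by simp
  also have "\<dots> = C * (A * B)" unfolding BA
    by (rule assoc_mult_mat[OF cC A cB])
  also have "\<dots> = C * A * C" unfolding AB
    by (rule assoc_mult_mat[OF cC A cC, symmetric])
  finally show ?thesis using c by simp
qed

lemma full_col_rank_kernel:
  fixes A :: "real mat"
  assumes A: "A \<in> carrier_mat m r" and rank: "vec_space.rank m A = r"
    and v: "v \<in> carrier_vec r" and Av: "A *\<^sub>v v = 0\<^sub>v m"
  shows "v = 0\<^sub>v r"
proof -
  interpret vec_space "TYPE(real)" m .
  \<comment> \<open>A repeated column would leave too few distinct columns to span dimension \<open>r\<close>.\<close>
  have dist: "distinct (cols A)"
  proof -
    obtain U where U: "maximal U (\<lambda>T. T \<subseteq> set (cols A) \<and> lin_indpt T)"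
      using maximal_exists[of "\<lambda>T. T \<subseteq> set (cols A) \<and> lin_indpt T" "card (set (cols A))" "{}"]
      by (meson List.finite_set card_mono empty_iff empty_subsetI finite_lin_indpt2
          rev_finite_subset)
    have "r = card U" using rank_card_indpt[OF A U] rank by simp
    also have "\<dots> \<le> card (set (cols A))" using U by (simp add: card_mono maximal_def)
    finally show ?thesis
      using A card_length[of "cols A"] by (intro card_distinct) auto
  qed
  have "lin_indpt (set (cols A))"
    using full_rank_lin_indpt[OF A _ dist] rank by simp
  then show ?thesis
    using lin_depI[OF A v _ Av dist] by blast
qed

lemma gram_left_inverse:
  fixes A :: "real mat"
  assumes A: "A \<in> carrier_mat m r" and rank: "vec_space.rank m A = r"
  obtains G where "G \<in> carrier_mat r r"
    and "G * (transpose_mat A * A) = 1\<^sub>m r" and "(transpose_mat A * A) * G = 1\<^sub>m r"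
proof -
  let ?T = "transpose_mat A"
  have T: "?T \<in> carrier_mat r m" and TA: "?T * A \<in> carrier_mat r r" using A by auto
  have "det (?T * A) \<noteq> 0"
  proof
    assume "det (?T * A) = 0"
    then obtain v where v: "v \<in> carrier_vec r" "v \<noteq> 0\<^sub>v r" "(?T * A) *\<^sub>v v = 0\<^sub>v r"
      using det_0_iff_vec_prod_zero_field[OF TA] by blast
    have Av: "A *\<^sub>v v \<in> carrier_vec m" using A v by auto
    have "?T *\<^sub>v (A *\<^sub>v v) = 0\<^sub>v r"
      using v(3) assoc_mult_mat_vec[OF T A v(1)] by simp
    then have "(A *\<^sub>v v) \<bullet> (A *\<^sub>v v) = 0"
      using transpose_vec_mult_scalar[OF A v(1) Av] v(1) by simp
    then have "A *\<^sub>v v = 0\<^sub>v m"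
      using conjugate_square_eq_0_vec[OF Av] by simp
    then show False using full_col_rank_kernel[OF A rank v(1)] v(2) by simp
  qed
  from det_non_zero_imp_unit[OF TA this, of "()"] show thesis
    using that by (auto simp: Units_def ring_mat_def)
qed

text \<open>The witness is the classical formula \<open>A\<^sup>+ = (A\<^sup>T A)\<^sup>-\<^sup>1 A\<^sup>T\<close>.\<close>

lemma pseudo_inverse_left_inverse:
  fixes A :: "real mat"
  assumes A: "A \<in> carrier_mat m r" and rank: "vec_space.rank m A = r"
  shows "pseudo_inverse A \<in> carrier_mat r m" and "pseudo_inverse A * A = 1\<^sub>m r"
proof -
  let ?T = "transpose_mat A"
  obtain G where G: "G \<in> carrier_mat r r" and GL: "G * (?T * A) = 1\<^sub>m r"
    and GR: "(?T * A) * G = 1\<^sub>m r"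
    using gram_left_inverse[OF A rank] .
  have T: "?T \<in> carrier_mat r m" and TA: "?T * A \<in> carrier_mat r r" using A by auto
  have symTA: "transpose_mat (?T * A) = ?T * A"
    by (subst transpose_mult[OF T A]) simp
  have Gt: "transpose_mat G \<in> carrier_mat r r" using G by simp
  have "transpose_mat G * (?T * A) = transpose_mat ((?T * A) * G)"
    by (subst transpose_mult[OF TA G]) (simp add: symTA)
  then have GtL: "transpose_mat G * (?T * A) = 1\<^sub>m r" using GR by simp
  have "transpose_mat G = transpose_mat G * ((?T * A) * G)" using GR Gt by simp
  also have "\<dots> = (transpose_mat G * (?T * A)) * G"
    by (rule assoc_mult_mat[OF Gt TA G, symmetric])
  finally have symG: "transpose_mat G = G" using GtL G by simp
  define B where "B = G * ?T"
  have B: "B \<in> carrier_mat r m" using G T by (simp add: B_def)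
  have BA: "B * A = 1\<^sub>m r"
    unfolding B_def using assoc_mult_mat[OF G T A] GL by simp
  have "transpose_mat (A * B) = transpose_mat B * ?T" by (rule transpose_mult[OF A B])
  also have "transpose_mat B = A * G"
    unfolding B_def by (subst transpose_mult[OF G T]) (simp add: symG)
  also have "A * G * ?T = A * B" unfolding B_def by (rule assoc_mult_mat[OF A G T])
  finally have "is_pseudo_inverse A B"
    using A B BA assoc_mult_mat[OF A B A] by (auto simp: is_pseudo_inverse_def)
  then have "pseudo_inverse A = B"
    unfolding pseudo_inverse_def by (blast intro: is_pseudo_inverse_unique)
  with B BA show "pseudo_inverse A \<in> carrier_mat r m" "pseudo_inverse A * A = 1\<^sub>m r"
    by simp_all
qed

section \<open>Sampling and encoding as matrix products\<close>

lemma colwise_mult_mat: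
  assumes A: "A \<in> carrier_mat nr nc" and X: "X \<in> carrier_mat nc k"
    and f: "\<And>x. x \<in> carrier_vec nc \<Longrightarrow> f x = A *\<^sub>v x"
  shows "colwise nr f X = A * X"
proof (rule eq_matI)
  fix i j assume ij: "i < dim_row (A * X)" "j < dim_col (A * X)"
  have "colwise nr f X $$ (i, j) = f (col X j) $ i"
    using ij A X by (simp add: colwise_def mat_of_cols_index)
  also have "\<dots> = (A *\<^sub>v col X j) $ i" using X f[of "col X j"] by auto
  also have "\<dots> = (A * X) $$ (i, j)" using ij A X by simp
  finally show "colwise nr f X $$ (i, j) = (A * X) $$ (i, j)" .
qed (use A X in \<open>auto simp: colwise_def\<close>)

definition sampling_mat :: "nat list \<Rightarrow> nat \<Rightarrow> real mat" where
  "sampling_mat I n = mat (length I) n (\<lambda>(i, j). if j = I ! i then 1 else 0)"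

lemma sampling_mat_carrier [simp]: "sampling_mat I n \<in> carrier_mat (length I) n"
  by (simp add: sampling_mat_def)

lemma sample_eq_mult:
  assumes I: "set I \<subseteq> {..<n}" and s: "s \<in> carrier_vec n"
  shows "sample I s = sampling_mat I n *\<^sub>v s"
proof (rule eq_vecI)
  fix i assume "i < dim_vec (sampling_mat I n *\<^sub>v s)"
  then have i: "i < length I" by (simp add: sampling_mat_def)
  then have Ii: "I ! i < n" using I nth_mem by blast
  have "(sampling_mat I n *\<^sub>v s) $ i = (\<Sum>j = 0..<n. (if j = I ! i then 1 else 0) * s $ j)"
    using i s by (simp add: sampling_mat_def scalar_prod_def)
  also have "\<dots> = (\<Sum>j = 0..<n. if j = I ! i then s $ j else 0)"
    by (intro sum.cong) auto
  also have "\<dots> = s $ (I ! i)" using Ii by (simp)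
  finally show "sample I s $ i = (sampling_mat I n *\<^sub>v s) $ i"
    using i by (simp add: sample_def vec_of_list_index del: vec_of_list_map)
qed (simp add: sample_def sampling_mat_def)

section \<open>The ridge regression minimizer\<close>

lemma quadratic_nonneg_imp_linear_coeff_0:
  fixes b c :: real
  assumes c: "0 \<le> c" and nonneg: "\<And>t. 0 \<le> 2 * t * b + t\<^sup>2 * c"
  shows "b = 0"
proof (rule ccontr)
  assume b: "b \<noteq> 0"
  \<comment> \<open>The vertex is at \<open>-b/c\<close>; the shift to \<open>c + 1\<close> also covers \<open>c = 0\<close>.\<close>
  define u where "u = 1 / (c + 1)"
  have u: "u > 0" and uc: "u * c = 1 - u" using c by (simp_all add: u_def field_simps)
  have "2 * (- b * u) * b + (- b * u)\<^sup>2 * c = b\<^sup>2 * u * (u * c - 2)"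
    by (simp add: power2_eq_square algebra_simps)
  also have "\<dots> < 0" using b u uc by (intro mult_pos_neg) auto
  finally show False using nonneg[of "- b * u"] by linarith
qed

text \<open>The objective is stationary at \<open>W\<close> in the direction \<open>B\<^sup>T X\<close> with \<open>X = B W\<close>. As \<open>B R = 0\<close>,
  moving \<open>B\<close> to the other side of the inner products leaves \<open>\<parallel>X H\<parallel>\<^sup>2 + \<gamma> \<parallel>X\<parallel>\<^sup>2 = 0\<close>.\<close>

lemma minimizer_annihilated:
  fixes B R H W :: "real mat"
  assumes B: "B \<in> carrier_mat r n" and R: "R \<in> carrier_mat n k"
    and H: "H \<in> carrier_mat p k" and W: "W \<in> carrier_mat n p"
    and gamma: "\<gamma> > 0" and BR: "B * R = 0\<^sub>m r k"
    and min: "\<And>W'. W' \<in> carrier_mat n p \<Longrightarrow>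
      (frobenius_norm (R + W * H))\<^sup>2 + \<gamma> * (frobenius_norm W)\<^sup>2 \<le>
      (frobenius_norm (R + W' * H))\<^sup>2 + \<gamma> * (frobenius_norm W')\<^sup>2"
  shows "B * W = 0\<^sub>m r p"
proof -
  define X where "X = B * W"
  define E where "E = transpose_mat B * X"
  have X: "X \<in> carrier_mat r p" using B W by (simp add: X_def)
  have XH: "X * H \<in> carrier_mat r k" using X H by simp
  have E: "E \<in> carrier_mat n p" using B X by (simp add: E_def)
  have WH: "W * H \<in> carrier_mat n k" and EH: "E * H \<in> carrier_mat n k" using W E H by auto
  define Q where "Q = R + W * H"
  have Q: "Q \<in> carrier_mat n k" using R WH by (simp add: Q_def)
  let ?b = "frob_inner Q (E * H) + \<gamma> * frob_inner W E"
  let ?c = "(frobenius_norm (E * H))\<^sup>2 + \<gamma> * (frobenius_norm E)\<^sup>2"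
  have "0 \<le> 2 * t * ?b + t\<^sup>2 * ?c" for t
  proof -
    have "R + (W + t \<cdot>\<^sub>m E) * H = R + (W * H + t \<cdot>\<^sub>m (E * H))"
      using W E H by (simp add: add_mult_distrib_mat[of _ n p] mult_smult_assoc_mat[of _ n p])
    also have "\<dots> = Q + t \<cdot>\<^sub>m (E * H)"
      unfolding Q_def using R WH EH by (simp add: assoc_add_mat[of _ n k])
    finally have *: "R + (W + t \<cdot>\<^sub>m E) * H = Q + t \<cdot>\<^sub>m (E * H)" .
    have "W + t \<cdot>\<^sub>m E \<in> carrier_mat n p" using W E by simp
    from min[OF this] show ?thesis
      unfolding * Q_def[symmetric] frobenius_norm_sq_add_smult[OF Q EH]
        frobenius_norm_sq_add_smult[OF W E]
      by (simp add: algebra_simps)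
  qed
  then have b0: "?b = 0"
    using gamma by (intro quadratic_nonneg_imp_linear_coeff_0[of ?c]) auto
  have "E * H = transpose_mat B * (X * H)"
    unfolding E_def using B X H by (intro assoc_mult_mat) auto
  moreover have "B * Q = X * H"
    unfolding Q_def X_def using B R WH W H BR XH[unfolded X_def]
    by (simp add: mult_add_distrib_mat[OF B R WH] assoc_mult_mat[OF B W H, symmetric]
        del: assoc_mult_mat)
  ultimately have "frob_inner Q (E * H) = (frobenius_norm (X * H))\<^sup>2"
    using frob_inner_adjoint[OF B Q XH] by (simp add: frobenius_norm_sq)
  moreover have "frob_inner W E = (frobenius_norm X)\<^sup>2"
    using frob_inner_adjoint[OF B W X] by (simp add: E_def X_def frobenius_norm_sq)
  ultimately have "(frobenius_norm (X * H))\<^sup>2 + \<gamma> * (frobenius_norm X)\<^sup>2 = 0"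
    using b0 by simp
  then have "\<gamma> * (frobenius_norm X)\<^sup>2 = 0"
    using gamma by (smt (verit) mult_nonneg_nonneg zero_le_power2)
  then show ?thesis
    using gamma frobenius_norm_eq_0[OF X] by (simp add: X_def)
qed

section \<open>Exact recovery on the quadratic manifold\<close>

theorem corollary1:
  fixes n m k r q :: nat and I :: "nat list" and S V W :: "real mat" and \<gamma> :: real
    and s :: "real vec"
  assumes "length I = m" and "set I \<subseteq> {..<n}"
    and "S \<in> carrier_mat n k" and "\<gamma> > 0" and "q > r"
    and "V \<in> carrier_mat n r" and "W \<in> carrier_mat n (quad_dim r)"
    and "qmsr I S \<gamma> q r V W"
    and "m \<ge> r" and "vec_space.rank m (sample_mat I V) = r"
    and "s \<in> quadratic_manifold r V W"
  shows "decoder V W (encoder I V (sample I s)) = s"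
proof -
  note I = assms(2) and S = assms(3) and V = assms(6) and W = assms(7)
  define P where "P = sampling_mat I n"
  have P: "P \<in> carrier_mat m n" using assms(1) by (auto simp: P_def)
  have sample: "sample I x = P *\<^sub>v x" if "x \<in> carrier_vec n" for x
    using sample_eq_mult[OF I that] by (simp add: P_def)
  have PV: "sample_mat I V = P * V" and PS: "sample_mat I S = P * S"
    using colwise_mult_mat[OF P V sample] colwise_mult_mat[OF P S sample] assms(1) by auto
  have PVc: "P * V \<in> carrier_mat m r" and PSc: "P * S \<in> carrier_mat m k" using P V S by auto
  define A where "A = pseudo_inverse (P * V)"
  have A: "A \<in> carrier_mat r m" and APV: "A * (P * V) = 1\<^sub>m r"
    using pseudo_inverse_left_inverse[OF PVc] assms(10) by (simp_all add: PV A_def)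
  have encoder: "encoder I V y = A *\<^sub>v y" for y
    by (simp add: encoder_def PV A_def)
  define B where "B = A * P"
  have B: "B \<in> carrier_mat r n" using A P by (simp add: B_def)
  have BV: "B * V = 1\<^sub>m r"
    unfolding B_def using APV assoc_mult_mat[OF A P V] by simp
  define Z where "Z = B * S"
  have Z: "Z \<in> carrier_mat r k" using B S by (simp add: Z_def)
  have Zcode: "colwise r (encoder I V) (sample_mat I S) = Z"
    unfolding PS Z_def B_def
    using colwise_mult_mat[OF A PSc encoder] assoc_mult_mat[OF A P S] by simp
  define H where "H = colwise (quad_dim r) quad_feature Z"
  have H: "H \<in> carrier_mat (quad_dim r) k"
    using Z by (auto simp: H_def colwise_def)
  define R where "R = V * Z - S"
  have R: "R \<in> carrier_mat n k" using V Z S by (auto simp: R_def)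
  have VZ: "V * Z \<in> carrier_mat n k" using V Z by simp
  have "B * R = B * (V * Z) - B * S"
    unfolding R_def by (rule mult_minus_distrib_mat[OF B VZ S])
  also have "B * (V * Z) = Z"
    using assoc_mult_mat[OF B V Z] BV Z by simp
  finally have BR: "B * R = 0\<^sub>m r k"
    using Z by (simp add: Z_def[symmetric])
  have objective: "objective I S \<gamma> V W' =
      (frobenius_norm (R + W' * H))\<^sup>2 + \<gamma> * (frobenius_norm W')\<^sup>2"
    if W': "W' \<in> carrier_mat n (quad_dim r)" for W'
  proof -
    have dim: "dim_col V = r" using V by simp
    have "V * Z + W' * H - S = R + W' * H"
      unfolding R_def using VZ W' H S by (intro eq_matI) auto
    then show ?thesis
      unfolding objective_def Let_def dim Zcode H_def[symmetric] by simp
  qed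
  have min: "objective I S \<gamma> V W \<le> objective I S \<gamma> V W'"
    if "W' \<in> carrier_mat n (quad_dim r)" for W'
    using assms(8) S that by (auto simp: qmsr_def is_arg_min_linorder)
  have BW: "B * W = 0\<^sub>m r (quad_dim r)"
    using min objective W
    by (intro minimizer_annihilated[OF B R H W assms(4) BR]) auto
  obtain z where z: "z \<in> carrier_vec r" and s: "s = V *\<^sub>v z + W *\<^sub>v quad_feature z"
    using assms(11) unfolding quadratic_manifold_def by blast
  have h: "quad_feature z \<in> carrier_vec (quad_dim r)"
    using z dim_quad_feature[of z] by (intro carrier_vecI) simp
  have Vz: "V *\<^sub>v z \<in> carrier_vec n" and Wh: "W *\<^sub>v quad_feature z \<in> carrier_vec n"
    using mult_mat_vec_carrier[OF V z] mult_mat_vec_carrier[OF W h] by auto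
  have "encoder I V (sample I s) = B *\<^sub>v s"
    using A P sample Vz Wh by (simp add: encoder B_def s)
  also have "\<dots> = (B * V) *\<^sub>v z + (B * W) *\<^sub>v quad_feature z"
    unfolding s
    using mult_add_distrib_mat_vec[OF B Vz Wh] assoc_mult_mat_vec[OF B V z]
      assoc_mult_mat_vec[OF B W h] by simp
  also have "\<dots> = z"
  proof -
    have "0\<^sub>m r (quad_dim r) *\<^sub>v quad_feature z = 0\<^sub>v r"
      using h by (intro eq_vecI) auto
    then show ?thesis using z by (simp add: BV BW)
  qed
  finally show ?thesis
    by (simp add: decoder_def s)
qed

end
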